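(* Let $a\in(-1,1)$ and let $h$ be a real-valued harmonic function from the unit disk $\mathbb{U}$ into $(-1,1)$ with $h(0)=a$. Then (i) $h(z)\le X^+(|z|,a)$ for all $z\in\mathbb{U}$; (ii) $|(dh)_0|\le \frac{\partial X^+}{\partial r}(0,a)=\frac4\pi\sin\alpha(a)$; and, moreover, (iii) $L(0,a)=\frac4\pi\sin\alpha(a)$.
   Context: $\mathbb{U}$ is the open unit disk in $\mathbb{C}$. For $a\in(-1,1)$ and $0\le r<1$ put $s(a)=\tan\big(\frac{\pi}{4}(a+1)\big)$, $\alpha(a)=\frac{\pi}{2}(a+1)$ and $X^+(r,a)=\frac4\pi\arctan\big(s(a)\frac{1+r}{1-r}\big)-1$. For $p\in\mathbb{U}$ and $b\in(-1,1)$, $L(p,b)=\sup|(du)_p|$, where the supremum is over all real-valued harmonic functions $u:\mathbb{U}\to(-1,1)$ with $u(p)=b$, and $|(du)_p|=|\nabla u(p)|$ is the norm of the differential. *)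

theory Defs
  imports "HOL-Analysis.Analysis"
begin

abbreviation unit_disk :: "complex set" where
  "unit_disk \<equiv> ball 0 1"

text \<open>Partial derivative in the direction \<open>v\<close>: \<open>pd 1\<close> is the derivative in \<open>x\<close> and
  \<open>pd \<i>\<close> the derivative in \<open>y\<close>, for \<open>z = x + \<i> y\<close>.  The value is meaningful where \<open>u\<close>
  is differentiable in the real sense.\<close>

definition pd :: "complex \<Rightarrow> (complex \<Rightarrow> real) \<Rightarrow> complex \<Rightarrow> real" where
  "pd v u z = frechet_derivative u (at z) v"

definition C1_on :: "(complex \<Rightarrow> real) \<Rightarrow> complex set \<Rightarrow> bool" where
  "C1_on u S \<longleftrightarrow> (\<forall>z\<in>S. u differentiable (at z)) \<and>
     continuous_on S (pd 1 u) \<and> continuous_on S (pd \<i> u)"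

definition C2_on :: "(complex \<Rightarrow> real) \<Rightarrow> complex set \<Rightarrow> bool" where
  "C2_on u S \<longleftrightarrow> C1_on u S \<and> C1_on (pd 1 u) S \<and> C1_on (pd \<i> u) S"

definition laplacian :: "(complex \<Rightarrow> real) \<Rightarrow> complex \<Rightarrow> real" where
  "laplacian u z = pd 1 (pd 1 u) z + pd \<i> (pd \<i> u) z"

definition harmonic_on :: "(complex \<Rightarrow> real) \<Rightarrow> complex set \<Rightarrow> bool" where
  "harmonic_on u S \<longleftrightarrow> open S \<and> C2_on u S \<and> (\<forall>z\<in>S. laplacian u z = 0)"

text \<open>The operator norm of the differential of \<open>u\<close> at \<open>p\<close>, i.e. the length of the gradient.\<close>

definition diff_norm :: "(complex \<Rightarrow> real) \<Rightarrow> complex \<Rightarrow> real" where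
  "diff_norm u p = onorm (frechet_derivative u (at p))"

definition s :: "real \<Rightarrow> real" where
  "s a = tan (pi / 4 * (a + 1))"

definition alpha :: "real \<Rightarrow> real" where
  "alpha a = pi / 2 * (a + 1)"

definition Xplus :: "real \<Rightarrow> real \<Rightarrow> real" where
  "Xplus r a = 4 / pi * arctan (s a * ((1 + r) / (1 - r))) - 1"

text \<open>The supremum is taken in the extended reals, so that a finite value of \<open>L p b\<close>
  includes the boundedness of the set of norms.\<close>

definition L :: "complex \<Rightarrow> real \<Rightarrow> ereal" where
  "L p b = (SUP u \<in> {u. harmonic_on u unit_disk \<and> u ` unit_disk \<subseteq> {-1<..<1} \<and> u p = b}.
     ereal (diff_norm u p))"

end

theory Submission
  imports Defs "HOL-Complex_Analysis.Complex_Analysis"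
begin

text \<open>
  The open strip \<open>-1 < Re w < 1\<close> is conformally equivalent to the disk, so the extremal problem
  becomes the Schwarz lemma once the harmonic function is known to be a real part.

  A harmonic \<open>h\<close> on the disk is \<open>Re f\<close> with \<open>f\<close> holomorphic and \<open>f 0 = a\<close>
  (\<open>harmonic_on_convex_imp_Re_holomorphic\<close>): the Laplace equation and the symmetry of the mixed
  partial derivatives are the Cauchy--Riemann equations for \<open>h\<^sub>x - \<i> h\<^sub>y\<close>, and a primitive of
  this function on a convex set has real part \<open>h\<close> up to a constant.

  The function \<open>F = exp (\<i> \<pi>/2 (f + 1))\<close> then maps the disk into the upper half-plane, its argument
  at \<open>z\<close> is \<open>alpha (h z)\<close>, and \<open>F 0 = cis (alpha a)\<close>. The Cayley transform
  \<open>G = (F - cis (alpha a)) / (F - cis (- alpha a))\<close> maps into the disk and vanishes at \<open>0\<close>. The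
  Schwarz inequality \<open>\<bar>G z\<bar> \<le> \<bar>z\<bar>\<close> confines \<open>F z\<close> to a hyperbolic disk about \<open>cis (alpha a)\<close>, whose
  points of largest argument lie on the unit circle (\<open>argument_bound\<close>); this is the bound by \<open>Xplus\<close>.
  The inequality \<open>\<bar>G' 0\<bar> \<le> 1\<close> bounds \<open>\<bar>f' 0\<bar>\<close>, which is the length of the gradient of \<open>h\<close>.

  Equality holds when \<open>G\<close> is the identity; solving for \<open>f\<close> gives the extremal function
  (\<open>extremal_holomorphic\<close>) that attains the supremum \<open>L 0 a\<close>.
\<close>

section \<open>Real parts of holomorphic functions\<close>

lemma has_derivative_Re_holomorphic:
  assumes "(f has_field_derivative f') (at z)" "open S" "z \<in> S"
    and "\<And>x. x \<in> S \<Longrightarrow> u x = Re (f x)"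
  shows "(u has_derivative (\<lambda>v. Re (f' * v))) (at z)"
proof -
  have "((\<lambda>x. Re (f x)) has_derivative (\<lambda>v. Re (f' * v))) (at z)"
    using assms(1) unfolding has_field_derivative_def
    by (rule bounded_linear.has_derivative[OF bounded_linear_Re])
  then show ?thesis
    by (rule has_derivative_transform_within_open[OF _ assms(2,3)]) (simp add: assms(4))
qed

lemma pd_Re_holomorphic:
  assumes "f holomorphic_on S" "open S" "z \<in> S"
    and "\<And>x. x \<in> S \<Longrightarrow> u x = Re (f x)"
  shows "pd v u z = Re (deriv f z * v)"
  using fun_cong[OF frechet_derivative_at[OF has_derivative_Re_holomorphic[OF
        holomorphic_derivI[OF assms(1-3)] assms(2-4)]], of v]
  by (simp add: pd_def)

lemma C1_on_Re_holomorphic: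
  assumes "f holomorphic_on S" "open S"
    and "\<And>x. x \<in> S \<Longrightarrow> u x = Re (f x)"
  shows "C1_on u S"
proof -
  have "continuous_on S (pd v u)" for v
  proof -
    have "continuous_on S (\<lambda>z. Re (deriv f z * v))"
      by (intro continuous_intros holomorphic_on_imp_continuous_on holomorphic_deriv assms)
    then show ?thesis
      by (rule continuous_on_cong[THEN iffD1, rotated -1])
        (simp_all add: pd_Re_holomorphic[OF assms(1,2) _ assms(3)])
  qed
  moreover have "u differentiable (at z)" if "z \<in> S" for z
    using has_derivative_Re_holomorphic[OF holomorphic_derivI[OF assms(1,2) that] assms(2) that assms(3)]
    unfolding differentiable_def by blast
  ultimately show ?thesis
    by (auto simp: C1_on_def)
qed

text \<open>Differentiating \<open>Re f\<close> in direction \<open>v\<close> gives \<open>Re (f' * v)\<close>, so the Laplacian is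
  \<open>Re (f'' * (1 + \<i>\<^sup>2)) = 0\<close>. All partial derivatives are again real parts of holomorphic
  functions, which gives the smoothness.\<close>

lemma harmonic_on_Re_holomorphic:
  assumes "f holomorphic_on S" "open S"
    and "\<And>x. x \<in> S \<Longrightarrow> u x = Re (f x)"
  shows "harmonic_on u S"
proof -
  have hol: "(\<lambda>z. deriv f z * v) holomorphic_on S" for v
    by (intro holomorphic_intros holomorphic_deriv assms)
  note pd1 = pd_Re_holomorphic[OF assms(1,2) _ assms(3)]
  have C1: "C1_on (pd v u) S" for v
    by (rule C1_on_Re_holomorphic[OF hol assms(2)]) (rule pd1)
  have "pd w (pd v u) z = Re (deriv (deriv f) z * v * w)" if "z \<in> S" for v w z
  proof -
    have "pd w (pd v u) z = Re (deriv (\<lambda>z. deriv f z * v) z * w)"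
      by (rule pd_Re_holomorphic[OF hol assms(2) that]) (rule pd1)
    also have "deriv (\<lambda>z. deriv f z * v) z = deriv (deriv f) z * v"
      using holomorphic_on_imp_differentiable_at[OF holomorphic_deriv[OF assms(1,2)] assms(2) that]
      by (simp add: deriv_cmult_right)
    finally show ?thesis .
  qed
  then have "laplacian u z = 0" if "z \<in> S" for z
    using that by (simp add: laplacian_def)
  with C1 C1_on_Re_holomorphic[OF assms] assms(2) show ?thesis
    by (auto simp: harmonic_on_def C2_on_def)
qed

text \<open>The differential is \<open>v \<mapsto> Re (f' z * v)\<close>; the Cauchy--Schwarz bound \<open>\<bar>f' z\<bar> \<bar>v\<bar>\<close> is attained in the
  direction of the gradient, \<open>v = cnj (f' z)\<close>.\<close>

lemma diff_norm_Re_holomorphic: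
  assumes "f holomorphic_on S" "open S" "z \<in> S"
    and "\<And>x. x \<in> S \<Longrightarrow> u x = Re (f x)"
  shows "diff_norm u z = cmod (deriv f z)"
proof -
  let ?c = "deriv f z"
  have der: "frechet_derivative u (at z) = (\<lambda>v. Re (?c * v))"
    using frechet_derivative_at[OF has_derivative_Re_holomorphic[OF
        holomorphic_derivI[OF assms(1-3)] assms(2-4)]] by simp
  have lin: "bounded_linear (\<lambda>v. Re (?c * v))"
    by (intro bounded_linear_compose[OF bounded_linear_Re] bounded_linear_mult_right)
  have "onorm (\<lambda>v. Re (?c * v)) \<le> cmod ?c"
    by (rule onorm_le) (metis abs_Re_le_cmod norm_mult real_norm_def)
  moreover have "cmod ?c \<le> onorm (\<lambda>v. Re (?c * v))"
  proof (cases "?c = 0")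
    case True
    then show ?thesis by (simp add: onorm_zero)
  next
    case False
    have "(cmod ?c)\<^sup>2 = norm (Re (?c * cnj ?c))"
      by (simp add: complex_mult_cnj cmod_power2)
    also have "\<dots> \<le> onorm (\<lambda>v. Re (?c * v)) * cmod (cnj ?c)"
      by (rule onorm[OF lin])
    finally show ?thesis
      using False by (simp add: power2_eq_square)
  qed
  ultimately show ?thesis
    by (simp add: diff_norm_def der)
qed

section \<open>Harmonic functions as real parts\<close>

text \<open>The second difference quotient is symmetric in \<open>v\<close> and \<open>w\<close>, so its limit proves that mixed
  derivatives agree. The mean value theorem in direction \<open>v\<close> turns it into a first difference of
  \<open>pd v u\<close> in direction \<open>w\<close>, taken at a point that moves with \<open>t\<close>; differentiability of \<open>pd v u\<close> at \<open>z\<close>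
  controls both terms of this difference up to \<open>o(t)\<close>.\<close>

lemma second_difference_tendsto:
  fixes u :: "complex \<Rightarrow> real"
  assumes "open S" "z \<in> S" and diff: "\<And>x. x \<in> S \<Longrightarrow> u differentiable (at x)"
    and diff2: "pd v u differentiable (at z)"
  shows "((\<lambda>t. (u (z + of_real t * v + of_real t * w) - u (z + of_real t * v)
            - u (z + of_real t * w) + u z) / t\<^sup>2) \<longlongrightarrow> pd w (pd v u) z) (at_right 0)"
proof (rule tendstoI)
  fix e :: real assume "e > 0"
  \<comment> \<open>Every point of the parallelogram with sides \<open>t v\<close> and \<open>t w\<close> is within \<open>t * M\<close> of \<open>z\<close>; the summand
    \<open>1\<close> keeps \<open>M\<close> positive.\<close>
  define M where "M = cmod v + cmod w + 1"
  define D where "D = frechet_derivative (pd v u) (at z)"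
  have "M > 0" by (simp add: M_def add_nonneg_pos)
  have D: "(pd v u has_derivative D) (at z)"
    using diff2 by (simp add: D_def frechet_derivative_works)
  interpret D: bounded_linear D
    using D by (rule has_derivative_bounded_linear)
  \<comment> \<open>Two linearisation errors of at most \<open>e / 4 * t\<close> occur below, which leaves \<open>e / 2\<close> after division
    by \<open>t\<close>.\<close>
  have "e / (4 * M) > 0" using \<open>e > 0\<close> \<open>M > 0\<close> by simp
  with D obtain d where "d > 0" and d:
    "\<And>y. cmod (y - z) < d \<Longrightarrow> \<bar>pd v u y - pd v u z - D (y - z)\<bar> \<le> e / (4 * M) * cmod (y - z)"
    unfolding has_derivative_at_alt real_norm_def by blast
  obtain d' where "d' > 0" and d': "ball z d' \<subseteq> S"
    using assms(1,2) open_contains_ball by blast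
  define \<delta> where "\<delta> = min d d' / M"
  have "\<delta> > 0" using \<open>d > 0\<close> \<open>d' > 0\<close> \<open>M > 0\<close> by (simp add: \<delta>_def)
  have est: "\<bar>(u (z + of_real t * v + of_real t * w) - u (z + of_real t * v)
            - u (z + of_real t * w) + u z) / t\<^sup>2 - D w\<bar> < e" if t: "0 < t" "t < \<delta>" for t
  proof -
    have tM: "t * M < min d d'"
      using t \<open>M > 0\<close> by (simp add: \<delta>_def field_simps)
    have small: "cmod (of_real x * v + of_real y * w) \<le> t * M"
      if "0 \<le> x" "x \<le> t" "0 \<le> y" "y \<le> t" for x y
    proof -
      have "cmod (of_real x * v + of_real y * w) \<le> x * cmod v + y * cmod w"
        using norm_triangle_ineq[of "of_real x * v" "of_real y * w"] that by (simp add: norm_mult)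
      also have "\<dots> \<le> t * cmod v + t * cmod w"
        using that by (intro add_mono mult_right_mono) auto
      also have "\<dots> \<le> t * M" using t by (simp add: M_def algebra_simps)
      finally show ?thesis .
    qed
    define F where "F x = u (z + of_real x * v + of_real t * w) - u (z + of_real x * v)" for x
    define p where "p = pd v u"
    have dir: "((\<lambda>x. u (c + of_real x * v)) has_field_derivative p (c + of_real x * v)) (at x)"
      if "c + of_real x * v \<in> S" for c x
    proof -
      have "(u has_derivative frechet_derivative u (at (c + of_real x * v))) (at (c + of_real x * v))"
        using diff[OF that] by (simp add: frechet_derivative_works)
      moreover have "((\<lambda>x. c + of_real x * v) has_derivative (\<lambda>y. of_real y * v)) (at x)"
        by (auto intro!: derivative_eq_intros)
      ultimately have *: "((\<lambda>x. u (c + of_real x * v)) has_derivative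
          (\<lambda>y. frechet_derivative u (at (c + of_real x * v)) (of_real y * v))) (at x)"
        by (rule has_derivative_compose[rotated])
      have "frechet_derivative u (at (c + of_real x * v)) (of_real y * v) = y * p (c + of_real x * v)" for y
        using linear_scale[OF linear_frechet_derivative[OF diff[OF that]], of y v]
        by (simp add: p_def pd_def scaleR_conv_of_real)
      with * show ?thesis
        by (simp add: has_field_derivative_def mult_commute_abs)
    qed
    have in_S: "z + of_real x * v + of_real y * w \<in> S"
      if "0 \<le> x" "x \<le> t" "0 \<le> y" "y \<le> t" for x y
      using small[OF that] tM d' by (auto simp: dist_norm subset_iff norm_minus_commute algebra_simps)
    have "(F has_field_derivative (p (z + of_real x * v + of_real t * w) - p (z + of_real x * v))) (at x)"
      if "0 \<le> x" "x \<le> t" for x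
    proof -
      have "((\<lambda>x. u (z + of_real t * w + of_real x * v)) has_field_derivative
          p (z + of_real t * w + of_real x * v)) (at x)"
        using in_S[of x t] that t by (intro dir) (simp add: algebra_simps)
      moreover have "((\<lambda>x. u (z + of_real x * v)) has_field_derivative p (z + of_real x * v)) (at x)"
        using in_S[of x 0] that t by (intro dir) simp
      ultimately show ?thesis
        unfolding F_def by (simp add: algebra_simps DERIV_diff)
    qed
    from MVT2[OF t(1) this] obtain \<xi> where \<xi>: "0 < \<xi>" "\<xi> < t"
      and F: "F t - F 0 = (t - 0) * (p (z + of_real \<xi> * v + of_real t * w) - p (z + of_real \<xi> * v))"
      by blast
    have close: "\<bar>p (z + (of_real \<xi> * v + of_real y * w)) - p z - D (of_real \<xi> * v + of_real y * w)\<bar>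
        \<le> e / 4 * t" if "0 \<le> y" "y \<le> t" for y
    proof -
      have sm: "cmod (of_real \<xi> * v + of_real y * w) \<le> t * M"
        using \<xi> that by (intro small) auto
      then have "\<bar>p (z + (of_real \<xi> * v + of_real y * w)) - p z - D (of_real \<xi> * v + of_real y * w)\<bar>
          \<le> e / (4 * M) * cmod (of_real \<xi> * v + of_real y * w)"
        using d[of "z + (of_real \<xi> * v + of_real y * w)"] tM by (simp add: p_def)
      also have "\<dots> \<le> e / (4 * M) * (t * M)"
        using sm \<open>e / (4 * M) > 0\<close> by (intro mult_left_mono) auto
      finally show ?thesis using \<open>M > 0\<close> by simp
    qed
    have Dw: "D (of_real \<xi> * v + of_real t * w) = D (of_real \<xi> * v) + t * D w"
      by (simp add: D.add D.scale flip: scaleR_conv_of_real)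
    have "\<bar>p (z + of_real \<xi> * v + of_real t * w) - p z - (D (of_real \<xi> * v) + t * D w)\<bar> \<le> e / 4 * t"
      using close[of t] t unfolding Dw by (simp add: add.assoc)
    moreover have "\<bar>p (z + of_real \<xi> * v) - p z - D (of_real \<xi> * v)\<bar> \<le> e / 4 * t"
      using close[of 0] t by simp
    ultimately have "\<bar>(p (z + of_real \<xi> * v + of_real t * w) - p (z + of_real \<xi> * v)) - t * D w\<bar> \<le> e / 2 * t"
      unfolding abs_le_iff by linarith
    then have "\<bar>((p (z + of_real \<xi> * v + of_real t * w) - p (z + of_real \<xi> * v)) - t * D w) / t\<bar> \<le> e / 2"
      using t by (simp add: abs_divide divide_le_eq)
    also have "((p (z + of_real \<xi> * v + of_real t * w) - p (z + of_real \<xi> * v)) - t * D w) / t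
        = (F t - F 0) / t\<^sup>2 - D w"
      unfolding F using t by (simp add: field_simps power2_eq_square)
    finally show ?thesis
      using \<open>e > 0\<close> by (simp add: F_def algebra_simps)
  qed
  show "\<forall>\<^sub>F t in at_right 0. dist ((u (z + of_real t * v + of_real t * w) - u (z + of_real t * v)
            - u (z + of_real t * w) + u z) / t\<^sup>2) (pd w (pd v u) z) < e"
    unfolding eventually_at_right_field
    using est \<open>\<delta> > 0\<close> by (auto simp: dist_real_def pd_def[of w] D_def)
qed

lemma pd_commute:
  assumes "open S" "z \<in> S" "\<And>x. x \<in> S \<Longrightarrow> u differentiable (at x)"
    and "pd v u differentiable (at z)" "pd w u differentiable (at z)"
  shows "pd w (pd v u) z = pd v (pd w u) z"
proof (rule tendsto_unique)
  let ?q = "\<lambda>t. (u (z + of_real t * v + of_real t * w) - u (z + of_real t * v)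
            - u (z + of_real t * w) + u z) / t\<^sup>2"
  show "(?q \<longlongrightarrow> pd w (pd v u) z) (at_right 0)"
    by (rule second_difference_tendsto[OF assms(1-4)])
  have "?q = (\<lambda>t. (u (z + of_real t * w + of_real t * v) - u (z + of_real t * w)
            - u (z + of_real t * v) + u z) / t\<^sup>2)"
    by (simp add: fun_eq_iff algebra_simps)
  then show "(?q \<longlongrightarrow> pd v (pd w u) z) (at_right 0)"
    using second_difference_tendsto[OF assms(1-3,5), of v] by simp
qed simp

lemma frechet_derivative_pd:
  assumes "u differentiable (at z)"
  shows "frechet_derivative u (at z) v = Re v * pd 1 u z + Im v * pd \<i> u z"
proof -
  interpret linear "frechet_derivative u (at z)"
    using assms by (rule linear_frechet_derivative)
  have "v = Re v *\<^sub>R 1 + Im v *\<^sub>R \<i>"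
    by (simp add: complex_eq_iff)
  then have "frechet_derivative u (at z) v
      = frechet_derivative u (at z) (Re v *\<^sub>R 1 + Im v *\<^sub>R \<i>)"
    by simp
  then show ?thesis
    unfolding pd_def by (simp only: add scale real_scaleR_def)
qed

text \<open>For \<open>u\<^sub>x - \<i> u\<^sub>y\<close>, one Cauchy--Riemann equation is Laplace's equation and the other is the
  equality of the mixed derivatives.\<close>

lemma harmonic_gradient_holomorphic:
  assumes "harmonic_on u S"
  shows "(\<lambda>z. Complex (pd 1 u z) (- pd \<i> u z)) holomorphic_on S"
proof -
  have "open S" using assms by (simp add: harmonic_on_def)
  have "(\<lambda>z. Complex (pd 1 u z) (- pd \<i> u z)) field_differentiable (at z)" if z: "z \<in> S" for z
  proof -
    let ?p = "pd 1 u" and ?q = "pd \<i> u"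
    have diff: "\<And>x. x \<in> S \<Longrightarrow> u differentiable (at x)"
      and p: "?p differentiable (at z)" and q: "?q differentiable (at z)"
      and lap: "pd 1 ?p z + pd \<i> ?q z = 0"
      using assms z by (auto simp: harmonic_on_def C2_on_def C1_on_def laplacian_def)
    have lap': "pd \<i> ?q z = - pd 1 ?p z"
      using lap by linarith
    have comm: "pd \<i> ?p z = pd 1 ?q z"
      by (rule pd_commute[OF \<open>open S\<close> z diff p q])
    have "((\<lambda>z. of_real (?p z) - \<i> * of_real (?q z)) has_derivative
        (\<lambda>v. of_real (frechet_derivative ?p (at z) v) - \<i> * of_real (frechet_derivative ?q (at z) v))) (at z)"
      using p q unfolding frechet_derivative_works
      by (auto intro!: derivative_intros)
    also have "(\<lambda>v. of_real (frechet_derivative ?p (at z) v) - \<i> * of_real (frechet_derivative ?q (at z) v))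
       = (*) (Complex (pd 1 ?p z) (- pd 1 ?q z))"
      by (simp add: fun_eq_iff complex_eq_iff frechet_derivative_pd[OF p] frechet_derivative_pd[OF q]
          comm lap' algebra_simps)
    finally show ?thesis
      unfolding field_differentiable_def has_field_derivative_def
      by (auto simp: Complex_eq)
  qed
  then show ?thesis
    by (simp add: holomorphic_on_def field_differentiable_at_within)
qed

text \<open>If \<open>u = Re f\<close>, the Cauchy--Riemann equations force \<open>f' = u\<^sub>x - \<i> u\<^sub>y\<close>. So \<open>f\<close> has to be a
  primitive of that function, and convexity supplies one. The imaginary part is free up to a
  constant, which is used to normalise it at \<open>z0\<close>.\<close>

proposition harmonic_on_convex_imp_Re_holomorphic:
  assumes "harmonic_on u S" "convex S" "z0 \<in> S"
  obtains f where "f holomorphic_on S" "\<And>z. z \<in> S \<Longrightarrow> u z = Re (f z)" "Im (f z0) = 0"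
proof -
  have "open S" using assms by (simp add: harmonic_on_def)
  obtain g where g_within: "\<And>x. x \<in> S \<Longrightarrow> (g has_field_derivative Complex (pd 1 u x) (- pd \<i> u x)) (at x within S)"
    using holomorphic_convex_primitive'[OF assms(2) \<open>open S\<close> harmonic_gradient_holomorphic[OF assms(1)]]
    by blast
  have g: "(g has_field_derivative Complex (pd 1 u x) (- pd \<i> u x)) (at x)" if "x \<in> S" for x
    using g_within[OF that] at_within_open[OF that \<open>open S\<close>] by simp
  have "((\<lambda>x. u x - Re (g x)) has_derivative (\<lambda>h. 0)) (at x within S)" if x: "x \<in> S" for x
  proof -
    have diff: "u differentiable (at x)"
      using assms x by (auto simp: harmonic_on_def C2_on_def C1_on_def)
    have "((\<lambda>x. u x - Re (g x)) has_derivative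
        (\<lambda>v. frechet_derivative u (at x) v - Re (Complex (pd 1 u x) (- pd \<i> u x) * v))) (at x)"
      using diff unfolding frechet_derivative_works
      by (intro has_derivative_diff has_derivative_Re_holomorphic[OF g[OF x] \<open>open S\<close> x refl])
    also have "(\<lambda>v. frechet_derivative u (at x) v - Re (Complex (pd 1 u x) (- pd \<i> u x) * v)) = (\<lambda>v. 0)"
      by (simp add: fun_eq_iff frechet_derivative_pd[OF diff] mult.commute)
    finally show ?thesis
      by (rule has_derivative_at_withinI)
  qed
  then have const: "u z - Re (g z) = u z0 - Re (g z0)" if "z \<in> S" for z
    using has_derivative_zero_unique[OF assms(2), of "\<lambda>x. u x - Re (g x)"] that assms(3) by blast
  have "g holomorphic_on S"
    unfolding holomorphic_on_open[OF \<open>open S\<close>] using g by blast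
  show ?thesis
  proof
    show "(\<lambda>z. g z + (of_real (u z0) - g z0)) holomorphic_on S"
      by (intro holomorphic_intros \<open>g holomorphic_on S\<close>)
    show "u z = Re (g z + (of_real (u z0) - g z0))" if "z \<in> S" for z
      using const[OF that] by simp
  qed simp
qed

section \<open>The strip, the half-plane and the disk\<close>

lemma cos_eq_sin_half: "cos x = 1 - 2 * (sin (x / 2))\<^sup>2" for x :: real
  using cos_double_sin[of "x / 2"] by simp

lemma cmod_diff_cis_squared:
  "(cmod (rcis \<rho> \<theta> - cis \<phi>))\<^sup>2 = (\<rho> - 1)\<^sup>2 + 4 * \<rho> * (sin ((\<theta> - \<phi>) / 2))\<^sup>2"
proof -
  have "(cmod (rcis \<rho> \<theta> - cis \<phi>))\<^sup>2
      = \<rho>\<^sup>2 * ((cos \<theta>)\<^sup>2 + (sin \<theta>)\<^sup>2) + ((cos \<phi>)\<^sup>2 + (sin \<phi>)\<^sup>2) - 2 * \<rho> * cos (\<theta> - \<phi>)"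
    unfolding cmod_power2 cos_diff Re_rcis Im_rcis minus_complex.sel cis.sel by algebra
  then show ?thesis
    unfolding cos_eq_sin_half[of "\<theta> - \<phi>"] cos_squared_eq
    by (simp add: power2_eq_square algebra_simps)
qed

text \<open>A point of the upper half-plane is closer to \<open>cis \<phi>\<close> than to its mirror image: the difference of
  the squared distances is \<open>4 \<rho> sin \<theta> sin \<phi>\<close>.\<close>

lemma cmod_diff_cis_less:
  assumes "0 < \<rho>" "0 < \<theta>" "\<theta> < pi" "0 < \<phi>" "\<phi> < pi"
  shows "cmod (rcis \<rho> \<theta> - cis \<phi>) < cmod (rcis \<rho> \<theta> - cis (- \<phi>))"
proof -
  have "0 < sin \<theta> * sin \<phi>"
    using assms by (simp add: sin_gt_zero)
  moreover have "sin \<theta> * sin \<phi> = (sin ((\<theta> + \<phi>) / 2))\<^sup>2 - (sin ((\<theta> - \<phi>) / 2))\<^sup>2"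
    using cos_eq_sin_half[of "\<theta> - \<phi>"] cos_eq_sin_half[of "\<theta> + \<phi>"]
    unfolding cos_diff cos_add by linarith
  ultimately have "(cmod (rcis \<rho> \<theta> - cis \<phi>))\<^sup>2 < (cmod (rcis \<rho> \<theta> - cis (- \<phi>)))\<^sup>2"
    using assms by (simp add: cmod_diff_cis_squared)
  then show ?thesis
    by (rule power_less_imp_less_base) simp
qed

text \<open>With \<open>p\<close> and \<open>q\<close> the sines of half of \<open>\<theta> - \<phi>\<close> and \<open>\<theta> + \<phi>\<close>, the squared hypothesis compares
  \<open>(\<rho> - 1)\<^sup>2 + 4 \<rho> p\<^sup>2\<close> with \<open>r\<^sup>2 ((\<rho> - 1)\<^sup>2 + 4 \<rho> q\<^sup>2)\<close>. Since \<open>r \<le> 1\<close>, the radial parts can be dropped: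
  \<open>\<rho> = 1\<close> is the least restrictive modulus. What remains, \<open>p \<le> r q\<close>, is linear in \<open>tan (\<theta> / 2)\<close> after
  division by the cosines of \<open>\<theta> / 2\<close> and \<open>\<phi> / 2\<close>.\<close>

lemma argument_bound:
  assumes "0 < \<rho>" "0 < \<theta>" "\<theta> < pi" "0 < \<phi>" "\<phi> < pi" "0 \<le> r" "r < 1"
    and le: "cmod (rcis \<rho> \<theta> - cis \<phi>) \<le> r * cmod (rcis \<rho> \<theta> - cis (- \<phi>))"
  shows "\<theta> \<le> 2 * arctan (tan (\<phi> / 2) * ((1 + r) / (1 - r)))"
proof -
  define p where "p = sin ((\<theta> - \<phi>) / 2)"
  define q where "q = sin ((\<theta> + \<phi>) / 2)"
  have "q > 0" unfolding q_def using assms by (intro sin_gt_zero) auto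
  have "(cmod (rcis \<rho> \<theta> - cis \<phi>))\<^sup>2 \<le> (r * cmod (rcis \<rho> \<theta> - cis (- \<phi>)))\<^sup>2"
    using le by (rule power_mono) simp
  then have "(\<rho> - 1)\<^sup>2 + 4 * \<rho> * p\<^sup>2 \<le> r\<^sup>2 * ((\<rho> - 1)\<^sup>2 + 4 * \<rho> * q\<^sup>2)"
    by (simp add: power_mult_distrib cmod_diff_cis_squared p_def q_def)
  moreover have "r\<^sup>2 * (\<rho> - 1)\<^sup>2 \<le> (\<rho> - 1)\<^sup>2"
    using assms by (intro mult_left_le_one_le) (auto simp: power_le_one)
  ultimately have "4 * \<rho> * p\<^sup>2 \<le> 4 * \<rho> * (r * q)\<^sup>2"
    by (simp add: algebra_simps power_mult_distrib)
  then have "p\<^sup>2 \<le> (r * q)\<^sup>2"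
    using assms by simp
  then have "p \<le> r * q"
    by (rule power2_le_imp_le) (use \<open>q > 0\<close> assms in simp)
  moreover have pos: "cos (\<theta> / 2) > 0" "cos (\<phi> / 2) > 0"
    using assms by (auto intro!: cos_gt_zero_pi)
  moreover have "p = (tan (\<theta> / 2) - tan (\<phi> / 2)) * (cos (\<theta> / 2) * cos (\<phi> / 2))"
    "q = (tan (\<theta> / 2) + tan (\<phi> / 2)) * (cos (\<theta> / 2) * cos (\<phi> / 2))"
  proof -
    have sin: "sin (\<theta> / 2) = tan (\<theta> / 2) * cos (\<theta> / 2)" "sin (\<phi> / 2) = tan (\<phi> / 2) * cos (\<phi> / 2)"
      using pos by (simp_all add: tan_def)
    show "p = (tan (\<theta> / 2) - tan (\<phi> / 2)) * (cos (\<theta> / 2) * cos (\<phi> / 2))"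
      unfolding p_def diff_divide_distrib sin_diff sin by (simp add: algebra_simps)
    show "q = (tan (\<theta> / 2) + tan (\<phi> / 2)) * (cos (\<theta> / 2) * cos (\<phi> / 2))"
      unfolding q_def add_divide_distrib sin_add sin by (simp add: algebra_simps)
  qed
  ultimately have "(tan (\<theta> / 2) - tan (\<phi> / 2)) * (cos (\<theta> / 2) * cos (\<phi> / 2))
      \<le> (r * (tan (\<theta> / 2) + tan (\<phi> / 2))) * (cos (\<theta> / 2) * cos (\<phi> / 2))"
    by (simp only: mult.assoc)
  then have "tan (\<theta> / 2) - tan (\<phi> / 2) \<le> r * (tan (\<theta> / 2) + tan (\<phi> / 2))"
    by (rule mult_right_le_imp_le) (use pos in simp)
  then have "tan (\<theta> / 2) \<le> tan (\<phi> / 2) * ((1 + r) / (1 - r))"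
    using assms by (simp add: field_simps)
  then have "arctan (tan (\<theta> / 2)) \<le> arctan (tan (\<phi> / 2) * ((1 + r) / (1 - r)))"
    by (simp add: arctan_le_iff)
  moreover have "arctan (tan (\<theta> / 2)) = \<theta> / 2"
    using assms by (intro arctan_tan) auto
  ultimately show ?thesis by simp
qed

lemma alpha_bounds:
  assumes "a \<in> {-1<..<1}"
  shows "0 < alpha a" "alpha a < pi"
proof -
  show "0 < alpha a" using assms by (simp add: alpha_def)
  have "pi / 2 * (a + 1) < pi / 2 * 2" using assms by (intro mult_strict_left_mono) auto
  then show "alpha a < pi" by (simp add: alpha_def)
qed

text \<open>Both bounds are the Schwarz lemma for the composition of \<open>f\<close> with the conformal map from the
  strip to the disk that sends \<open>a\<close> to \<open>0\<close>: the first is the growth bound and the second the bound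
  on the derivative at the centre.\<close>

lemma
  assumes f: "f holomorphic_on unit_disk" and strip: "\<And>z. z \<in> unit_disk \<Longrightarrow> Re (f z) \<in> {-1<..<1}"
    and f0: "f 0 = of_real a"
  shows Re_le_Xplus: "z \<in> unit_disk \<Longrightarrow> Re (f z) \<le> Xplus (cmod z) a"
    and cmod_deriv_le: "cmod (deriv f 0) \<le> 4 / pi * sin (alpha a)"
proof -
  have "a \<in> {-1<..<1}" using strip[of 0] f0 by simp
  note \<alpha> = alpha_bounds[OF this]
  define F where "F z = exp (\<i> * of_real (pi / 2) * (f z + 1))" for z
  have F_rcis: "F z = rcis (exp (- (pi / 2) * Im (f z))) (alpha (Re (f z)))" for z
  proof -
    have "\<i> * of_real (pi / 2) * (f z + 1)
        = of_real (- (pi / 2) * Im (f z)) + \<i> * of_real (alpha (Re (f z)))"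
      by (simp add: complex_eq_iff alpha_def)
    then show ?thesis
      by (simp only: F_def rcis_def cis_conv_exp exp_add exp_of_real)
  qed
  have less: "cmod (F z - cis (alpha a)) < cmod (F z - cis (- alpha a))" if "z \<in> unit_disk" for z
    unfolding F_rcis using alpha_bounds[OF strip[OF that]] \<alpha>
    by (intro cmod_diff_cis_less) auto
  then have nz: "F z - cis (- alpha a) \<noteq> 0" if "z \<in> unit_disk" for z
    using that by fastforce
  define G where "G z = (F z - cis (alpha a)) / (F z - cis (- alpha a))" for z
  have F0: "F 0 = cis (alpha a)"
    by (simp add: F_rcis f0 rcis_def)
  have holF: "F holomorphic_on unit_disk"
    unfolding F_def by (intro holomorphic_intros f)
  have holG: "G holomorphic_on unit_disk"
    unfolding G_def using nz by (intro holomorphic_intros holF) auto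
  have G0: "G 0 = 0" by (simp add: G_def F0)
  have G1: "cmod (G z) < 1" if "cmod z < 1" for z
  proof -
    have "z \<in> unit_disk" using that by simp
    from less[OF this] nz[OF this] show ?thesis
      by (simp add: G_def norm_divide divide_less_eq)
  qed
  note Schwarz = Schwarz_Lemma[OF holG G0 G1]
  show "Re (f z) \<le> Xplus (cmod z) a" if z: "z \<in> unit_disk"
  proof -
    have "cmod (G z) \<le> cmod z" using Schwarz(1)[of z] z by simp
    then have "cmod (F z - cis (alpha a)) \<le> cmod z * cmod (F z - cis (- alpha a))"
      using nz[OF z] by (simp add: G_def norm_divide divide_le_eq)
    then have "alpha (Re (f z)) \<le> 2 * arctan (tan (alpha a / 2) * ((1 + cmod z) / (1 - cmod z)))"
      unfolding F_rcis using alpha_bounds[OF strip[OF z]] \<alpha> z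
      by (intro argument_bound) auto
    moreover have "alpha a / 2 = pi / 4 * (a + 1)"
      by (simp add: alpha_def)
    ultimately show ?thesis
      by (simp add: Xplus_def s_def alpha_def field_simps)
  qed
  have "(f has_field_derivative deriv f 0) (at 0)"
    by (rule holomorphic_derivI[OF f]) auto
  then have dF: "(F has_field_derivative F 0 * (\<i> * of_real (pi / 2) * deriv f 0)) (at 0)"
    unfolding F_def by (auto intro!: derivative_eq_intros)
  have cc: "cis (alpha a) - cis (- alpha a) = 2 * \<i> * sin (alpha a)"
    by (simp add: complex_eq_iff)
  have "sin (alpha a) > 0" using \<alpha> by (intro sin_gt_zero)
  have "(G has_field_derivative (F 0 * (\<i> * of_real (pi / 2) * deriv f 0)) / (2 * \<i> * sin (alpha a))) (at 0)"
    unfolding G_def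
    by (rule derivative_eq_intros dF refl nz)+ 
      (use nz[of 0] \<open>sin (alpha a) > 0\<close> in \<open>auto simp: F0 cc field_simps\<close>)
  then have "deriv G 0 = (F 0 * (\<i> * of_real (pi / 2) * deriv f 0)) / (2 * \<i> * sin (alpha a))"
    by (rule DERIV_imp_deriv)
  then have "cmod (deriv G 0) = pi / 2 * cmod (deriv f 0) / (2 * sin (alpha a))"
    using \<open>sin (alpha a) > 0\<close> by (simp add: norm_mult norm_divide F0)
  with Schwarz(2)[of 0] have "pi / 2 * cmod (deriv f 0) / (2 * sin (alpha a)) \<le> 1"
    by simp
  then show "cmod (deriv f 0) \<le> 4 / pi * sin (alpha a)"
    using \<open>sin (alpha a) > 0\<close> by (simp add: field_simps)
qed

section \<open>The extremal function\<close>

text \<open>The inverse of the conformal map from the strip to the disk: \<open>W\<close> inverts the Cayley transform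
  \<open>w \<mapsto> (w - cis (alpha a)) / (w - cis (- alpha a))\<close>, and \<open>-2\<i>/\<pi> Ln w - 1\<close> inverts
  \<open>w \<mapsto> exp (\<i> \<pi>/2 (w + 1))\<close> on the half-plane.\<close>

lemma extremal_holomorphic:
  assumes "a \<in> {-1<..<1}"
  obtains f where "f holomorphic_on unit_disk" "\<And>z. z \<in> unit_disk \<Longrightarrow> Re (f z) \<in> {-1<..<1}"
    "f 0 = of_real a" "cmod (deriv f 0) = 4 / pi * sin (alpha a)"
proof -
  note \<alpha> = alpha_bounds[OF assms]
  define W where "W z = (cis (alpha a) - cis (- alpha a) * z) / (1 - z)" for z
  have "sin (alpha a) > 0" using \<alpha> by (intro sin_gt_zero)
  have ne: "1 - z \<noteq> 0" if "z \<in> unit_disk" for z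
    using that by auto
  have ImW: "Im (W z) > 0" if "z \<in> unit_disk" for z
  proof -
    have "Im (W z) = sin (alpha a) * (1 - (cmod z)\<^sup>2) / (cmod (1 - z))\<^sup>2"
      unfolding W_def Im_divide cmod_power2
      by (rule arg_cong2[of _ _ _ _ "(/)"]) (simp_all add: power2_eq_square algebra_simps)
    moreover have "(cmod z)\<^sup>2 < 1"
      using that by (simp add: abs_square_less_1)
    ultimately show ?thesis
      using \<open>sin (alpha a) > 0\<close> ne[OF that] by simp
  qed
  define f where "f z = - \<i> * of_real (2 / pi) * Ln (W z) - 1" for z
  have W_notin: "W z \<notin> \<real>\<^sub>\<le>\<^sub>0" if "z \<in> unit_disk" for z
    using ImW[OF that] by (auto simp: complex_nonpos_Reals_iff)
  have holW: "W holomorphic_on unit_disk"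
    unfolding W_def using ne by (intro holomorphic_intros) auto
  have W0: "W 0 = cis (alpha a)" by (simp add: W_def)
  show ?thesis
  proof
    show "f holomorphic_on unit_disk"
      unfolding f_def using W_notin by (intro holomorphic_intros holW) auto
    show "Re (f z) \<in> {-1<..<1}" if "z \<in> unit_disk" for z
    proof -
      have "W z \<noteq> 0" using ImW[OF that] by auto
      then have "0 < Im (Ln (W z))" "Im (Ln (W z)) < pi"
        using ImW[OF that] Im_Ln_pos_lt_imp[of "W z"] Im_Ln_pos_lt[of "W z"] by auto
      then show ?thesis
        by (simp add: f_def field_simps)
    qed
    have "Ln (W 0) = \<i> * of_real (alpha a)"
      unfolding W0 cis_conv_exp using \<alpha> by (intro Ln_exp) auto
    then show "f 0 = of_real a"
      by (simp add: f_def alpha_def field_simps)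
    have "(W has_field_derivative cis (alpha a) - cis (- alpha a)) (at 0)"
      unfolding W_def by (auto intro!: derivative_eq_intros)
    then have "(f has_field_derivative
        - \<i> * of_real (2 / pi) * ((cis (alpha a) - cis (- alpha a)) / W 0)) (at 0)"
      unfolding f_def using W_notin[of 0]
      by (auto intro!: derivative_eq_intros simp: divide_inverse)
    then have "deriv f 0 = - \<i> * of_real (2 / pi) * ((cis (alpha a) - cis (- alpha a)) / cis (alpha a))"
      unfolding W0 by (rule DERIV_imp_deriv)
    also have "cis (alpha a) - cis (- alpha a) = 2 * \<i> * sin (alpha a)"
      by (simp add: complex_eq_iff)
    finally show "cmod (deriv f 0) = 4 / pi * sin (alpha a)"
      using \<open>sin (alpha a) > 0\<close> by (simp add: norm_mult norm_divide)
  qed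
qed

text \<open>At \<open>r = 0\<close> the derivative of the fraction is \<open>2\<close>, so that of \<open>arctan\<close> gives \<open>2 s / (1 + s\<^sup>2)\<close>, the
  half-angle formula for \<open>sin (alpha a)\<close>, since \<open>s a\<close> is the tangent of \<open>alpha a / 2\<close>.\<close>

lemma DERIV_Xplus_0:
  "((\<lambda>r. Xplus r a) has_real_derivative (4 / pi * sin (alpha a))) (at 0 within S)"
proof -
  have "((\<lambda>r. Xplus r a) has_real_derivative (4 / pi * (2 * s a / (1 + (s a)\<^sup>2)))) (at 0 within S)"
    unfolding Xplus_def by (auto intro!: derivative_eq_intros simp: field_simps add_nonneg_eq_0_iff)
  also have "2 * s a / (1 + (s a)\<^sup>2) = sin (alpha a)"
  proof -
    have "alpha a = 2 * (pi / 4 * (a + 1))" by (simp add: alpha_def)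
    then show ?thesis
      unfolding s_def by (simp only: sin_tan_half)
  qed
  finally show ?thesis .
qed

section \<open>The Schwarz lemma for harmonic functions\<close>

lemma harmonic_strip_bounds:
  assumes "harmonic_on h unit_disk" "h ` unit_disk \<subseteq> {-1<..<1}" "h 0 = a"
  shows "(\<forall>z\<in>unit_disk. h z \<le> Xplus (cmod z) a) \<and> diff_norm h 0 \<le> 4 / pi * sin (alpha a)"
proof -
  obtain f where f: "f holomorphic_on unit_disk" "\<And>z. z \<in> unit_disk \<Longrightarrow> h z = Re (f z)"
    and "Im (f 0) = 0"
    using harmonic_on_convex_imp_Re_holomorphic[OF assms(1) convex_ball, of 0] by auto
  then have "f 0 = of_real a"
    using assms(3) by (simp add: complex_eq_iff)
  moreover have "Re (f z) \<in> {-1<..<1}" if "z \<in> unit_disk" for z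
    using assms(2) that unfolding f(2)[OF that, symmetric] by blast
  ultimately show ?thesis
    using Re_le_Xplus[OF f(1)] cmod_deriv_le[OF f(1)] f(2)
      diff_norm_Re_holomorphic[OF f(1) open_ball _ f(2), of 0]
    by simp
qed

theorem theorem2:
  fixes a :: real and h :: "complex \<Rightarrow> real"
  assumes "a \<in> {-1<..<1}"
    and "harmonic_on h unit_disk"
    and "h ` unit_disk \<subseteq> {-1<..<1}"
    and "h 0 = a"
  shows "(\<forall>z\<in>unit_disk. h z \<le> Xplus (cmod z) a) \<and>
    (((\<lambda>r. Xplus r a) has_real_derivative (4 / pi * sin (alpha a))) (at 0 within {0..<1}) \<and>
     diff_norm h 0 \<le> 4 / pi * sin (alpha a)) \<and>
    L 0 a = ereal (4 / pi * sin (alpha a))"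
proof -
  obtain f where f: "f holomorphic_on unit_disk" "\<And>z. z \<in> unit_disk \<Longrightarrow> Re (f z) \<in> {-1<..<1}"
    "f 0 = of_real a" "cmod (deriv f 0) = 4 / pi * sin (alpha a)"
    using extremal_holomorphic[OF assms(1)] by blast
  have "L 0 a = ereal (4 / pi * sin (alpha a))"
    unfolding L_def
  proof (rule antisym[OF SUP_least SUP_upper2])
    show "(\<lambda>z. Re (f z)) \<in> {u. harmonic_on u unit_disk \<and> u ` unit_disk \<subseteq> {-1<..<1} \<and> u 0 = a}"
      using harmonic_on_Re_holomorphic[OF f(1) open_ball refl] f(2,3) by auto
    show "ereal (4 / pi * sin (alpha a)) \<le> ereal (diff_norm (\<lambda>z. Re (f z)) 0)"
      using diff_norm_Re_holomorphic[OF f(1) open_ball _ refl, of 0] f(4) by simp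
  qed (use harmonic_strip_bounds in auto)
  then show ?thesis
    using DERIV_Xplus_0 harmonic_strip_bounds[OF assms(2-4)] by blast
qed

end
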